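(* Let $d>0$, let $w$ be a weight function on $\mathcal{D}_d$ that is even on $\mathbb{R}$, and let $K$, $Q$ and $F^{\mathrm{C}}_{K,Q}(n)$ be as defined in the context, where $n$ is a positive integer. If $\alpha_n>0$ satisfies $$\frac{2\alpha_n}{\pi\tanh(d)}\cdot\frac{Q(\alpha_n)^2+Q'(\alpha_n)^2}{Q(\alpha_n)}\le n,$$ then $$\frac{F^{\mathrm{C}}_{K,Q}(n)}{n}\ge\frac{Q(\alpha_n)}{2}.$$
   Context: Let $d>0$ and $\mathcal{D}_d:=\{z\in\mathbb{C}\mid |\mathrm{Im}\,z|<d\}$. A weight function is a function $w:\mathcal{D}_d\to\mathbb{C}$ satisfying: (1) $w$ is analytic and does not vanish on $\mathcal{D}_d$, and takes values in $(0,1]$ on $\mathbb{R}$; (2) $\lim_{x\to\pm\infty}\int_{-d}^{d}|w(x+iy)|\,\mathrm{d}y=0$ and $\lim_{y\nearrow d}\int_{-\infty}^{\infty}(|w(x+iy)|+|w(x-iy)|)\,\mathrm{d}x<\infty$; (3) $\log w$ is strictly concave on $\mathbb{R}$. For $x\in\mathbb{R}$ define $$K(x):=-\log\left|\tanh\left(\frac{\pi}{4d}x\right)\right|\in[0,\infty]\quad(K(0)=+\infty),\qquad Q(x):=-\log w(x).$$ Let $\mathcal{M}(\mathbb{R},n)$ be the set of all (positive) Borel measures $\mu$ on $\mathbb{R}$ with $\mu(\mathbb{R})=n$. The continuous energy of $\mu\in\mathcal{M}(\mathbb{R},n)$ is $$I_n^{\mathrm{C}}(\mu):=\int_{\mathbb{R}}\int_{\mathbb{R}}K(x-y)\,\mathrm{d}\mu(x)\,\mathrm{d}\mu(y)+2\int_{\mathbb{R}}Q(x)\,\mathrm{d}\mu(x).$$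 It is known that $I_n^{\mathrm{C}}$ has a unique minimizer $\mu_n^*$ over $\mathcal{M}(\mathbb{R},n)$, and that it has compact support. Define $$F^{\mathrm{C}}_{K,Q}(n):=I_n^{\mathrm{C}}(\mu_n^* )-\int_{\mathbb{R}}Q(x)\,\mathrm{d}\mu_n^*(x)=\int_{\mathbb{R}}\int_{\mathbb{R}}K(x-y)\,\mathrm{d}\mu_n^*(x)\,\mathrm{d}\mu_n^*(y)+\int_{\mathbb{R}}Q(x)\,\mathrm{d}\mu_n^*(x).$$ *)

theory Defs
  imports "HOL-Analysis.Analysis"
begin

definition strip :: "real \<Rightarrow> complex set" where
  "strip d = {z. \<bar>Im z\<bar> < d}"

definition strictly_concave_on :: "real set \<Rightarrow> (real \<Rightarrow> real) \<Rightarrow> bool" where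
  "strictly_concave_on S f \<longleftrightarrow> convex S \<and>
     (\<forall>x\<in>S. \<forall>y\<in>S. \<forall>t. x \<noteq> y \<and> 0 < t \<and> t < 1 \<longrightarrow>
        f ((1 - t) * x + t * y) > (1 - t) * f x + t * f y)"

text \<open>Only the values of a weight function on the strip matter; its values elsewhere are
  unconstrained and never used.  The integrals of its modulus are taken in the extended
  non-negative reals, so that a divergent integral has the value infinity (rather than the
  default value 0 of the Bochner integral).\<close>

definition weight_function :: "real \<Rightarrow> (complex \<Rightarrow> complex) \<Rightarrow> bool" where
  "weight_function d w \<longleftrightarrow>
     w analytic_on strip d \<and>
     (\<forall>z\<in>strip d. w z \<noteq> 0) \<and>
     (\<forall>x::real. w (of_real x) \<in> of_real ` {0<..1}) \<and>
     ((\<lambda>x. \<integral>\<^sup>+y\<in>{-d<..<d}. ennreal (cmod (w (Complex x y))) \<partial>lborel) \<longlongrightarrow> 0) at_top \<and>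
     ((\<lambda>x. \<integral>\<^sup>+y\<in>{-d<..<d}. ennreal (cmod (w (Complex x y))) \<partial>lborel) \<longlongrightarrow> 0) at_bot \<and>
     (\<exists>L<\<infinity>. ((\<lambda>y. \<integral>\<^sup>+x. ennreal (cmod (w (Complex x y)) + cmod (w (Complex x (- y)))) \<partial>lborel)
               \<longlongrightarrow> L) (at_left d)) \<and>
     strictly_concave_on UNIV (\<lambda>x. ln (Re (w (of_real x))))"

text \<open>The case distinction is needed because \<^term>\<open>ln (0::real) = 0\<close> in the library.\<close>

definition kernel_K :: "real \<Rightarrow> real \<Rightarrow> ennreal" where
  "kernel_K d x = (if x = 0 then \<infinity> else ennreal (- ln \<bar>tanh (pi / (4 * d) * x)\<bar>))"

definition field_Q :: "(complex \<Rightarrow> complex) \<Rightarrow> real \<Rightarrow> real" where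
  "field_Q w x = - ln (Re (w (of_real x)))"

definition borel_measures :: "nat \<Rightarrow> real measure set" where
  "borel_measures n = {\<mu>. sets \<mu> = sets borel \<and> emeasure \<mu> UNIV = of_nat n}"

text \<open>For a weight function, \<^term>\<open>field_Q w\<close> is non-negative, so the coercion to the extended
  non-negative reals below does not truncate it.\<close>

definition continuous_energy :: "real \<Rightarrow> (complex \<Rightarrow> complex) \<Rightarrow> real measure \<Rightarrow> ennreal" where
  "continuous_energy d w \<mu> =
     (\<integral>\<^sup>+y. \<integral>\<^sup>+x. kernel_K d (x - y) \<partial>\<mu> \<partial>\<mu>) + 2 * (\<integral>\<^sup>+x. ennreal (field_Q w x) \<partial>\<mu>)"

definition energy_minimizer ::
    "real \<Rightarrow> (complex \<Rightarrow> complex) \<Rightarrow> nat \<Rightarrow> real measure \<Rightarrow> bool" where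
  "energy_minimizer d w n \<mu> \<longleftrightarrow> \<mu> \<in> borel_measures n \<and>
     (\<forall>\<nu>\<in>borel_measures n. continuous_energy d w \<mu> \<le> continuous_energy d w \<nu>)"

text \<open>The constant $F^C_{K,Q}(n)$ is the value of this functional at the minimizer of
  the energy over \<^term>\<open>borel_measures n\<close>.\<close>

definition F_C :: "real \<Rightarrow> (complex \<Rightarrow> complex) \<Rightarrow> real measure \<Rightarrow> ennreal" where
  "F_C d w \<mu> =
     (\<integral>\<^sup>+y. \<integral>\<^sup>+x. kernel_K d (x - y) \<partial>\<mu> \<partial>\<mu>) + (\<integral>\<^sup>+x. ennreal (field_Q w x) \<partial>\<mu>)"

end

theory Submission
  imports Defs
begin

text \<open>
  Write \<open>q = Q \<alpha>\<close>, \<open>p = Q' \<alpha>\<close>, and \<open>E\<close> for the interaction energy, the double integral of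
  \<open>K\<close> against \<open>\<mu>\<close>.  The two terms of the functional compete: for \<open>\<integral>Q d\<mu>\<close> to be much smaller
  than \<open>n q\<close>, a positive measure of mass \<open>n\<close> has to pack its mass into \<open>[-\<alpha>, \<alpha>]\<close>, and then
  its repulsion \<open>E\<close> is large.

  To quantify the repulsion, \<open>K\<close> is bounded below pointwise by \<open>2 exp (-r \<bar>x\<bar>)\<close>, for any
  \<open>r \<ge> \<pi>/(2d)\<close> (\<open>kernel_K_ge_exp\<close>).  The exponential kernel is an explicit square: with
  \<open>k x s = exp (-r (s - x))\<close> for \<open>s \<ge> x\<close> and \<open>0\<close> otherwise,
  \<open>exp (-r \<bar>x - y\<bar>) = 2 r \<integral> k x s k y s ds\<close>.  Hence \<open>E \<ge> 4 r \<integral> M\<^sup>2\<close>, where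
  \<open>M s = \<integral> k x s d\<mu>(x)\<close> (\<open>energy_ge_nn_integral_square\<close>).

  To quantify the gain in field energy, convexity and evenness of \<open>Q\<close> show that the deficit
  \<open>q - Q\<close> is positive at most on \<open>[-\<alpha>, \<alpha>]\<close>, where it is bounded by \<open>q\<close> (as \<open>Q \<ge> 0\<close>) and by the tangent line
  \<open>p (\<alpha> - x)\<close>.  Such a function is dominated by \<open>(r q + p) \<integral> k x s ds\<close> over
  \<open>s \<in> [-\<alpha>, \<alpha>]\<close> (\<open>min_const_linear_le_exp\<close>), so that
  \<open>n q \<le> \<integral>Q d\<mu> + (r q + p) \<integral> M\<close>, the last integral being over \<open>[-\<alpha>, \<alpha>]\<close>.

  The linear term in \<open>M\<close> is absorbed by the quadratic one at the cost of
  \<open>\<alpha> (r q + p)\<^sup>2 / (8 r)\<close> (\<open>energy_plus_field_ge\<close>).  With \<open>r = 16 / (3 \<pi> tanh d)\<close> the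
  hypothesis on \<open>\<alpha>\<close> implies that this cost is at most \<open>n q / 2\<close>, which leaves
  \<open>E + \<integral>Q d\<mu> \<ge> n q / 2\<close>.
\<close>

section \<open>Elementary inequalities\<close>

lemma two_mult_le_ln_quotient:
  fixes y :: real
  assumes "0 \<le> y" "y < 1"
  shows "2 * y \<le> ln ((1 + y) / (1 - y))"
proof -
  let ?f = "\<lambda>t::real. ln (1 + t) - ln (1 - t) - 2 * t"
  have "?f 0 \<le> ?f y"
  proof (rule DERIV_nonneg_imp_nondecreasing[OF assms(1)])
    fix t :: real
    assume t: "0 \<le> t" "t \<le> y"
    with assms have t1: "t < 1" by simp
    have "(?f has_real_derivative 1 / (1 + t) + 1 / (1 - t) - 2) (at t)"
      using t t1 by (auto intro!: derivative_eq_intros)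
    moreover have "1 / (1 + t) + 1 / (1 - t) - 2 = 2 * t\<^sup>2 / (1 - t\<^sup>2)"
    proof -
      have "t\<^sup>2 < 1" using t t1 by (simp add: power_less_one_iff abs_square_less_1)
      moreover have "1 - t\<^sup>2 = (1 + t) * (1 - t)" by (simp add: power2_eq_square algebra_simps)
      ultimately show ?thesis using t t1 by (simp add: field_simps power2_eq_square)
    qed
    moreover have "0 \<le> 2 * t\<^sup>2 / (1 - t\<^sup>2)"
      using t t1 by (simp add: power_le_one)
    ultimately show "\<exists>D. (?f has_real_derivative D) (at t) \<and> 0 \<le> D" by metis
  qed
  then show ?thesis using assms by (simp add: ln_div)
qed

lemma tanh_le_self:
  fixes x :: real
  assumes "0 \<le> x"
  shows "tanh x \<le> x"
proof -
  have "0 - tanh 0 \<le> x - tanh x"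
  proof (rule DERIV_nonneg_imp_nondecreasing[OF assms])
    fix t :: real
    have "((\<lambda>x. x - tanh x) has_real_derivative (tanh t)\<^sup>2) (at t)"
      by (auto intro!: derivative_eq_intros)
    then show "\<exists>D. ((\<lambda>x. x - tanh x) has_real_derivative D) (at t) \<and> 0 \<le> D"
      by (meson zero_le_power2)
  qed
  then show ?thesis by simp
qed

text \<open>
  The right-hand side is the integral of \<open>r q + p\<close> against the exponential over an interval of
  length \<open>u\<close>, which dominates anything that is below both \<open>q\<close> and \<open>p u\<close>.  The reason is that
  \<open>(1 - exp (-r u)) / r \<ge> u / (1 + r u)\<close>, while weighting \<open>m \<le> q\<close> with \<open>r u\<close> and \<open>m \<le> p u\<close>
  with \<open>1\<close> gives \<open>m (1 + r u) \<le> (r q + p) u\<close>.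
\<close>

lemma min_const_linear_le_exp:
  fixes m p q r u :: real
  assumes "r > 0" "u \<ge> 0" "p \<ge> 0" "q \<ge> 0" "m \<le> q" "m \<le> p * u"
  shows "m \<le> (r * q + p) * ((1 - exp (- r * u)) / r)"
proof -
  have ru: "0 \<le> r * u" using assms by simp
  have "exp (- r * u) \<le> 1 / (1 + r * u)"
  proof -
    have "1 + r * u \<le> exp (r * u)" by (rule exp_ge_add_one_self)
    then have "1 / exp (r * u) \<le> 1 / (1 + r * u)" using ru by (intro frac_le) auto
    then show ?thesis by (simp add: exp_minus inverse_eq_divide)
  qed
  moreover have "r * u / (1 + r * u) = 1 - 1 / (1 + r * u)"
    using ru by (simp add: field_simps)
  ultimately have "r * u / (1 + r * u) \<le> 1 - exp (- r * u)" by linarith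
  then have "u / (1 + r * u) \<le> (1 - exp (- r * u)) / r"
    using assms(1) by (simp add: field_simps)
  then have "(r * q + p) * (u / (1 + r * u)) \<le> (r * q + p) * ((1 - exp (- r * u)) / r)"
    using assms by (intro mult_left_mono) auto
  moreover have "m \<le> (r * q + p) * (u / (1 + r * u))"
  proof -
    have "r * u * m \<le> r * u * q" using ru assms by (intro mult_left_mono) auto
    then have "m * (1 + r * u) \<le> (r * q + p) * u" using assms(6) by (simp add: algebra_simps)
    then show ?thesis using ru by (simp add: field_simps)
  qed
  ultimately show ?thesis by linarith
qed

text \<open>
  Completing the square, in a form that allows \<open>M\<close> to be infinite.
\<close>

lemma ennreal_mult_le_square_plus_const:
  fixes M :: ennreal and a c :: real
  assumes "a > 0" "c \<ge> 0"
  shows "ennreal c * M \<le> ennreal a * M\<^sup>2 + ennreal (c\<^sup>2 / (4 * a))"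
proof (cases M)
  case (real m)
  have "0 \<le> (2 * a * m - c)\<^sup>2 / (4 * a)" using assms by simp
  also have "\<dots> = a * m\<^sup>2 + c\<^sup>2 / (4 * a) - c * m"
    using assms by (simp add: field_simps power2_eq_square)
  finally have "c * m \<le> a * m\<^sup>2 + c\<^sup>2 / (4 * a)" by simp
  then have "ennreal (c * m) \<le> ennreal (a * m\<^sup>2 + c\<^sup>2 / (4 * a))" by (rule ennreal_leI)
  then show ?thesis
    using assms real by (simp add: ennreal_mult' ennreal_power)
next
  case top
  then show ?thesis using assms by (simp add: ennreal_mult_top)
qed

section \<open>The interaction energy as a square\<close>

text \<open>
  With \<open>y = exp (-2 t)\<close> and \<open>t = \<pi> \<bar>x\<bar> / (4 d)\<close> one has \<open>tanh t = (1 - y) / (1 + y)\<close>, so the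
  kernel is \<open>ln ((1 + y) / (1 - y)) \<ge> 2 y = 2 exp (-\<pi> \<bar>x\<bar> / (2 d))\<close>.
\<close>

lemma kernel_K_ge_exp:
  assumes "d > 0" and r: "pi / (2 * d) \<le> r"
  shows "ennreal (2 * exp (- r * \<bar>x\<bar>)) \<le> kernel_K d x"
proof (cases "x = 0")
  case True
  then show ?thesis by (simp add: kernel_K_def)
next
  case False
  define t where "t = pi / (4 * d) * \<bar>x\<bar>"
  define y where "y = exp (- 2 * t)"
  have t: "t > 0" using False assms by (simp add: t_def)
  have y: "0 < y" "y < 1" using t by (auto simp: y_def)
  have tanh_t: "tanh t = (1 - y) / (1 + y)"
    unfolding y_def by (rule tanh_real_altdef)
  have abs_tanh: "\<bar>tanh (pi / (4 * d) * x)\<bar> = tanh t"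
  proof -
    have "\<bar>tanh (pi / (4 * d) * x)\<bar> = tanh \<bar>pi / (4 * d) * x\<bar>"
      by (rule tanh_real_abs[symmetric])
    also have "\<bar>pi / (4 * d) * x\<bar> = t" using assms by (simp add: t_def abs_mult)
    finally show ?thesis .
  qed
  have "2 * t = pi / (2 * d) * \<bar>x\<bar>" by (simp add: t_def)
  also have "\<dots> \<le> r * \<bar>x\<bar>" by (intro mult_right_mono r) auto
  finally have "2 * exp (- r * \<bar>x\<bar>) \<le> 2 * y" by (simp add: y_def)
  also have "\<dots> \<le> ln ((1 + y) / (1 - y))" using y by (intro two_mult_le_ln_quotient) auto
  also have "\<dots> = - ln (tanh t)" using y by (simp add: tanh_t ln_div)
  finally show ?thesis
    using False abs_tanh unfolding kernel_K_def by (metis ennreal_leI)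
qed

text \<open>
  This kernel is the fundamental solution of \<open>d/ds + r\<close>.  As a square root of the two-sided
  exponential it makes positive definiteness visible without Fourier transforms; being
  non-negative, it also lets all integrals be exchanged without integrability conditions.
\<close>

definition one_sided_exp :: "real \<Rightarrow> real \<Rightarrow> real \<Rightarrow> ennreal" where
  "one_sided_exp r x s = ennreal (exp (- r * (s - x))) * indicator {x..} s"

lemma borel_measurable_one_sided_exp [measurable]:
  "case_prod (one_sided_exp r) \<in> borel_measurable (borel \<Otimes>\<^sub>M borel)"
proof -
  have "case_prod (one_sided_exp r) =
      (\<lambda>(x, s). if x \<le> s then ennreal (exp (- r * (s - x))) else 0)"
    by (auto simp: one_sided_exp_def fun_eq_iff)
  also have "\<dots> \<in> borel_measurable (borel \<Otimes>\<^sub>M borel)" by measurable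
  finally show ?thesis .
qed

text \<open>
  The two factors are simultaneously nonzero from \<open>max x y\<close> on, where their product is
  \<open>exp (-r (2 s - x - y))\<close>; and \<open>2 max x y - x - y = \<bar>x - y\<bar>\<close>.
\<close>

lemma nn_integral_one_sided_exp_mult:
  assumes "r > 0"
  shows "(\<integral>\<^sup>+s. one_sided_exp r x s * one_sided_exp r y s \<partial>lborel)
    = ennreal (exp (- r * \<bar>x - y\<bar>) / (2 * r))"
proof -
  define m where "m = max x y"
  let ?F = "\<lambda>s. - exp (- r * (2 * s - x - y)) / (2 * r)"
  have "(\<integral>\<^sup>+s. one_sided_exp r x s * one_sided_exp r y s \<partial>lborel)
      = (\<integral>\<^sup>+s. ennreal (exp (- r * (2 * s - x - y))) * indicator {m..} s \<partial>lborel)"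
    by (intro nn_integral_cong)
       (auto simp: one_sided_exp_def m_def indicator_def ennreal_mult'[symmetric]
          exp_add[symmetric] algebra_simps)
  also have "\<dots> = ennreal (0 - ?F m)"
  proof (rule nn_integral_FTC_atLeast)
    fix s :: real
    show "(?F has_real_derivative exp (- r * (2 * s - x - y))) (at s)"
      using assms by (auto intro!: derivative_eq_intros)
  next
    have "filterlim (\<lambda>s. - r * (2 * s - x - y)) at_bot at_top"
    proof -
      have "filterlim (\<lambda>s. r * (x + y) + (- (2 * r)) * s) at_bot at_top"
        using assms
        by (subst filterlim_tendsto_add_at_bot_iff[OF tendsto_const])
           (rule filterlim_tendsto_neg_mult_at_bot[OF tendsto_const _ filterlim_ident], simp)
      then show ?thesis by (simp add: algebra_simps)
    qed
    then have "((\<lambda>s. exp (- r * (2 * s - x - y))) \<longlongrightarrow> 0) at_top"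
      by (rule filterlim_compose[OF exp_at_bot])
    then show "(?F \<longlongrightarrow> 0) at_top"
      using tendsto_mult_left[of _ 0 at_top "- 1 / (2 * r)"] by (simp add: field_simps)
  qed auto
  also have "0 - ?F m = exp (- r * \<bar>x - y\<bar>) / (2 * r)"
    by (auto simp: m_def max_def algebra_simps)
  finally show ?thesis .
qed

lemma nn_integral_one_sided_exp_upto:
  assumes "r > 0" "a \<le> x" "x \<le> b"
  shows "(\<integral>\<^sup>+s. one_sided_exp r x s * indicator {a..b} s \<partial>lborel)
    = ennreal ((1 - exp (- r * (b - x))) / r)"
proof -
  let ?F = "\<lambda>s. - exp (- r * (s - x)) / r"
  have "(\<integral>\<^sup>+s. one_sided_exp r x s * indicator {a..b} s \<partial>lborel)
      = (\<integral>\<^sup>+s. ennreal (exp (- r * (s - x))) * indicator {x..b} s \<partial>lborel)"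
    using assms(2) by (intro nn_integral_cong) (auto simp: one_sided_exp_def indicator_def)
  also have "\<dots> = ennreal (?F b - ?F x)"
  proof (rule nn_integral_FTC_Icc)
    fix s :: real
    show "(?F has_real_derivative exp (- r * (s - x))) (at s)"
      using assms by (auto intro!: derivative_eq_intros)
  qed (use assms in auto)
  also have "?F b - ?F x = (1 - exp (- r * (b - x))) / r"
    by (simp add: diff_divide_distrib)
  finally show ?thesis .
qed

lemma energy_ge_nn_integral_square:
  assumes "d > 0" and "r > 0" and r: "pi / (2 * d) \<le> r"
    and "finite_measure \<mu>" and sets_\<mu> [measurable_cong]: "sets \<mu> = sets borel"
  shows "ennreal (4 * r) * (\<integral>\<^sup>+s. (\<integral>\<^sup>+x. one_sided_exp r x s \<partial>\<mu>)\<^sup>2 \<partial>lborel)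
    \<le> (\<integral>\<^sup>+y. \<integral>\<^sup>+x. kernel_K d (x - y) \<partial>\<mu> \<partial>\<mu>)"
proof -
  interpret finite_measure \<mu> by fact
  interpret pair_sigma_finite lborel \<mu> ..
  let ?k = "one_sided_exp r"
  have "(\<integral>\<^sup>+s. (\<integral>\<^sup>+x. ?k x s \<partial>\<mu>)\<^sup>2 \<partial>lborel)
      = (\<integral>\<^sup>+s. \<integral>\<^sup>+y. \<integral>\<^sup>+x. ?k x s * ?k y s \<partial>\<mu> \<partial>\<mu> \<partial>lborel)"
    by (simp add: power2_eq_square nn_integral_multc nn_integral_cmult)
  also have "\<dots> = (\<integral>\<^sup>+y. \<integral>\<^sup>+s. \<integral>\<^sup>+x. ?k x s * ?k y s \<partial>\<mu> \<partial>lborel \<partial>\<mu>)"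
    by (rule Fubini'[symmetric]) measurable
  also have "\<dots> = (\<integral>\<^sup>+y. \<integral>\<^sup>+x. \<integral>\<^sup>+s. ?k x s * ?k y s \<partial>lborel \<partial>\<mu> \<partial>\<mu>)"
    by (intro nn_integral_cong Fubini'[symmetric]) measurable
  also have "\<dots> = (\<integral>\<^sup>+y. \<integral>\<^sup>+x. ennreal (exp (- r * \<bar>x - y\<bar>) / (2 * r)) \<partial>\<mu> \<partial>\<mu>)"
    using \<open>r > 0\<close> by (simp add: nn_integral_one_sided_exp_mult)
  finally have "ennreal (4 * r) * (\<integral>\<^sup>+s. (\<integral>\<^sup>+x. ?k x s \<partial>\<mu>)\<^sup>2 \<partial>lborel)
      = (\<integral>\<^sup>+y. \<integral>\<^sup>+x. ennreal (4 * r) * ennreal (exp (- r * \<bar>x - y\<bar>) / (2 * r)) \<partial>\<mu> \<partial>\<mu>)"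
    by (simp add: nn_integral_cmult)
  also have "\<dots> = (\<integral>\<^sup>+y. \<integral>\<^sup>+x. ennreal (2 * exp (- r * \<bar>x - y\<bar>)) \<partial>\<mu> \<partial>\<mu>)"
    using \<open>r > 0\<close> by (simp add: ennreal_mult'[symmetric])
  also have "\<dots> \<le> (\<integral>\<^sup>+y. \<integral>\<^sup>+x. kernel_K d (x - y) \<partial>\<mu> \<partial>\<mu>)"
    by (intro nn_integral_mono kernel_K_ge_exp assms)
  finally show ?thesis .
qed

section \<open>Trading interaction energy against field energy\<close>

text \<open>
  The one-sided exponentials started at the points of \<open>\<mu>\<close> pay for the deficit \<open>q - Q\<close>, and the
  interaction energy pays for the exponentials.  The last summand is the integral over
  \<open>[-\<alpha>, \<alpha>]\<close> of \<open>c\<^sup>2 / (16 r)\<close> with \<open>c = r q + p\<close>, which is the maximum of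
  \<open>c M - 4 r M\<^sup>2\<close> over all \<open>M\<close>.
\<close>

lemma energy_plus_field_ge:
  fixes Q :: "real \<Rightarrow> real"
  assumes "d > 0" and "r > 0" and r: "pi / (2 * d) \<le> r"
    and \<mu>: "finite_measure \<mu>" and sets_\<mu> [measurable_cong]: "sets \<mu> = sets borel"
    and [measurable]: "Q \<in> borel_measurable borel" and Q_nonneg: "\<And>x. 0 \<le> Q x"
    and "\<alpha> > 0" and "p \<ge> 0" and "q \<ge> 0"
    and inside: "\<And>x. \<bar>x\<bar> \<le> \<alpha> \<Longrightarrow> q - p * (\<alpha> - x) \<le> Q x"
    and outside: "\<And>x. \<alpha> < \<bar>x\<bar> \<Longrightarrow> q \<le> Q x"
  shows "ennreal q * emeasure \<mu> (space \<mu>)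
    \<le> (\<integral>\<^sup>+y. \<integral>\<^sup>+x. kernel_K d (x - y) \<partial>\<mu> \<partial>\<mu>) + (\<integral>\<^sup>+x. ennreal (Q x) \<partial>\<mu>)
        + ennreal (\<alpha> * (r * q + p)\<^sup>2 / (8 * r))"
proof -
  interpret finite_measure \<mu> by fact
  interpret pair_sigma_finite lborel \<mu> ..
  let ?k = "one_sided_exp r"
  let ?E = "\<integral>\<^sup>+y. \<integral>\<^sup>+x. kernel_K d (x - y) \<partial>\<mu> \<partial>\<mu>"
  let ?M = "\<lambda>s. \<integral>\<^sup>+x. ?k x s \<partial>\<mu>"
  define c where "c = r * q + p"
  have c: "c \<ge> 0" using assms by (simp add: c_def)
  have pointwise: "ennreal q \<le> ennreal (Q x)
      + ennreal c * (\<integral>\<^sup>+s. ?k x s * indicator {-\<alpha>..\<alpha>} s \<partial>lborel)" for x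
  proof (cases "\<bar>x\<bar> \<le> \<alpha>")
    case True
    let ?b = "(1 - exp (- r * (\<alpha> - x))) / r"
    have b: "0 \<le> ?b" using True \<open>r > 0\<close> by (simp add: divide_nonneg_pos)
    have "q - Q x \<le> c * ?b"
      unfolding c_def using True assms(2,9,10) inside[OF True] Q_nonneg[of x]
      by (intro min_const_linear_le_exp) auto
    then have "ennreal q \<le> ennreal (Q x + c * ?b)" by (intro ennreal_leI) simp
    also have "\<dots> = ennreal (Q x) + ennreal c * ennreal ?b"
      using b c Q_nonneg[of x] by (simp only: ennreal_plus ennreal_mult mult_nonneg_nonneg)
    also have "ennreal ?b = (\<integral>\<^sup>+s. ?k x s * indicator {-\<alpha>..\<alpha>} s \<partial>lborel)"
      using True \<open>r > 0\<close> by (intro nn_integral_one_sided_exp_upto[symmetric]) auto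
    finally show ?thesis .
  next
    case False
    then have "ennreal q \<le> ennreal (Q x)" by (intro ennreal_leI outside) simp
    then show ?thesis by (rule order_trans) simp
  qed
  have "ennreal q * emeasure \<mu> (space \<mu>) = (\<integral>\<^sup>+x. ennreal q \<partial>\<mu>)" by simp
  also have "\<dots> \<le> (\<integral>\<^sup>+x. ennreal (Q x)
      + ennreal c * (\<integral>\<^sup>+s. ?k x s * indicator {-\<alpha>..\<alpha>} s \<partial>lborel) \<partial>\<mu>)"
    by (intro nn_integral_mono pointwise)
  also have "\<dots> = (\<integral>\<^sup>+x. ennreal (Q x) \<partial>\<mu>)
      + ennreal c * (\<integral>\<^sup>+x. \<integral>\<^sup>+s. ?k x s * indicator {-\<alpha>..\<alpha>} s \<partial>lborel \<partial>\<mu>)"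
    by (simp add: nn_integral_add nn_integral_cmult)
  also have "(\<integral>\<^sup>+x. \<integral>\<^sup>+s. ?k x s * indicator {-\<alpha>..\<alpha>} s \<partial>lborel \<partial>\<mu>)
      = (\<integral>\<^sup>+s. \<integral>\<^sup>+x. ?k x s * indicator {-\<alpha>..\<alpha>} s \<partial>\<mu> \<partial>lborel)"
    by (rule Fubini') measurable
  also have "\<dots> = (\<integral>\<^sup>+s\<in>{-\<alpha>..\<alpha>}. ?M s \<partial>lborel)"
    by (simp add: nn_integral_multc)
  also have "ennreal c * \<dots> = (\<integral>\<^sup>+s\<in>{-\<alpha>..\<alpha>}. ennreal c * ?M s \<partial>lborel)"
    by (subst nn_integral_cmult[symmetric]) (simp_all add: mult.assoc)
  also have "\<dots> \<le> (\<integral>\<^sup>+s. ennreal (4 * r) * (?M s)\<^sup>2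
      + ennreal (c\<^sup>2 / (16 * r)) * indicator {-\<alpha>..\<alpha>} s \<partial>lborel)"
  proof (intro nn_integral_mono)
    fix s :: real
    show "ennreal c * ?M s * indicator {-\<alpha>..\<alpha>} s \<le> ennreal (4 * r) * (?M s)\<^sup>2
      + ennreal (c\<^sup>2 / (16 * r)) * indicator {-\<alpha>..\<alpha>} s"
      using ennreal_mult_le_square_plus_const[of "4 * r" c "?M s"] \<open>r > 0\<close> c
      by (simp add: indicator_def)
  qed
  also have "\<dots> = ennreal (4 * r) * (\<integral>\<^sup>+s. (?M s)\<^sup>2 \<partial>lborel)
      + ennreal (\<alpha> * c\<^sup>2 / (8 * r))"
  proof -
    have "(\<integral>\<^sup>+s. ennreal (c\<^sup>2 / (16 * r)) * indicator {-\<alpha>..\<alpha>} s \<partial>lborel)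
        = ennreal (c\<^sup>2 / (16 * r)) * ennreal (2 * \<alpha>)"
      using \<open>\<alpha> > 0\<close> by (subst nn_integral_cmult_indicator) auto
    also have "\<dots> = ennreal (c\<^sup>2 / (16 * r) * (2 * \<alpha>))"
      using \<open>r > 0\<close> \<open>\<alpha> > 0\<close> by (intro ennreal_mult[symmetric]) auto
    also have "c\<^sup>2 / (16 * r) * (2 * \<alpha>) = \<alpha> * c\<^sup>2 / (8 * r)" by simp
    finally show ?thesis by (simp add: nn_integral_add nn_integral_cmult)
  qed
  also have "\<dots> \<le> ?E + ennreal (\<alpha> * c\<^sup>2 / (8 * r))"
    by (intro add_right_mono energy_ge_nn_integral_square assms)
  finally show ?thesis by (simp add: c_def add_ac)
qed

section \<open>The external field of a weight function\<close>

lemma weight_function_real_axis: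
  assumes "weight_function d w"
  shows "Re (w (of_real x)) \<in> {0<..1}"
proof -
  have "w (of_real x) \<in> of_real ` {0<..1}"
    using assms unfolding weight_function_def by blast
  then show ?thesis by auto
qed

lemma field_Q_differentiable:
  assumes "d > 0" "weight_function d w"
  shows "field_Q w differentiable (at x)"
proof -
  have "of_real x \<in> strip d" using assms by (simp add: strip_def)
  moreover have "w analytic_on strip d" using assms(2) unfolding weight_function_def by blast
  ultimately obtain D where D: "(w has_field_derivative D) (at (of_real x))"
    using analytic_on_imp_differentiable_at field_differentiable_def by blast
  have "((\<lambda>x. w (of_real x)) has_vector_derivative D) (at x)"
    using D by (rule has_vector_derivative_real_field)
  then have "((\<lambda>x. Re (w (of_real x))) has_real_derivative Re D) (at x)"
    unfolding has_real_derivative_iff_has_vector_derivative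
    by (rule bounded_linear.has_vector_derivative[OF bounded_linear_Re])
  moreover have "Re (w (of_real x)) > 0"
    using weight_function_real_axis[OF assms(2)] by simp
  ultimately have "((\<lambda>x. ln (Re (w (of_real x)))) has_real_derivative
      1 / Re (w (of_real x)) * Re D) (at x)"
    by (intro DERIV_chain2[OF DERIV_ln_divide])
  from DERIV_minus[OF this]
  show ?thesis
    unfolding field_Q_def[abs_def] by (meson real_differentiable_def)
qed

lemma field_Q_nonneg:
  assumes "weight_function d w"
  shows "0 \<le> field_Q w x"
  using weight_function_real_axis[OF assms, of x] by (simp add: field_Q_def)

lemma convex_on_field_Q:
  assumes "weight_function d w"
  shows "convex_on UNIV (field_Q w)"
proof (rule convex_onI)
  fix t x y :: real
  assume t: "0 < t" "t < 1"
  have conc: "(1 - t) * ln (Re (w (of_real x))) + t * ln (Re (w (of_real y)))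
      < ln (Re (w (of_real ((1 - t) * x + t * y))))" if "x \<noteq> y"
  proof -
    have "strictly_concave_on UNIV (\<lambda>x. ln (Re (w (of_real x))))"
      using assms unfolding weight_function_def by blast
    then show ?thesis using t that unfolding strictly_concave_on_def by blast
  qed
  show "field_Q w ((1 - t) *\<^sub>R x + t *\<^sub>R y) \<le> (1 - t) * field_Q w x + t * field_Q w y"
  proof (cases "x = y")
    case True
    then show ?thesis by (simp add: algebra_simps)
  next
    case False
    from conc[OF this] show ?thesis by (simp add: field_Q_def)
  qed
qed simp

section \<open>The lower bound\<close>

theorem theorem2p4:
  fixes d \<alpha> :: real and w :: "complex \<Rightarrow> complex" and n :: nat and \<mu> :: "real measure"
  assumes "d > 0"
    and "weight_function d w"
    and "\<And>x::real. w (of_real (- x)) = w (of_real x)"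
    and "n > 0"
    and "energy_minimizer d w n \<mu>"
    and "\<alpha> > 0"
    and "2 * \<alpha> / (pi * tanh d) *
           (((field_Q w \<alpha>)\<^sup>2 + (deriv (field_Q w) \<alpha>)\<^sup>2) / field_Q w \<alpha>) \<le> real n"
  shows "F_C d w \<mu> / of_nat n \<ge> ennreal (field_Q w \<alpha> / 2)"
proof (cases "field_Q w \<alpha> = 0")
  case True
  then show ?thesis by simp
next
  case False
  let ?Q = "field_Q w"
  define q where "q = ?Q \<alpha>"
  define p where "p = deriv ?Q \<alpha>"
  define T where "T = pi * tanh d"
  (* The rate must be at least pi / (2 d), and tanh d <= d allows any multiple of 1 / T from
     pi^2 / 2 on.  The cost of q^2 grows with r; after splitting (r q + p)^2 with weights 3/2
     and 3, the value 16 / (3 T) is the largest for which the coefficient of q^2 / T is at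
     most 1.  It exceeds the lower limit because 3 pi^2 < 32. *)
  define r where "r = 16 / (3 * T)"
  have q: "q > 0" using False field_Q_nonneg[OF assms(2), of \<alpha>] by (simp add: q_def)
  have even: "?Q (- x) = ?Q x" for x
    using assms(3)[of x] by (simp add: field_Q_def)
  have tanh_d: "0 < tanh d" "tanh d < 1" "tanh d \<le> d"
    using assms(1) by (auto simp: tanh_real_lt_1 tanh_le_self)
  have T: "T > 0" using tanh_d by (simp add: T_def)
  have pi2: "pi\<^sup>2 < 10"
  proof -
    have "pi * pi < 3.15 * 3.15"
      using pi_approx by (intro mult_strict_mono) auto
    then show ?thesis by (simp add: power2_eq_square)
  qed
  have r0: "r > 0" using T by (simp add: r_def)
  have r_ge: "pi / (2 * d) \<le> r"
  proof -
    have "pi\<^sup>2 * tanh d \<le> 10 * d"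
      using pi2 tanh_d assms(1) by (intro mult_mono) auto
    then have "3 * (pi\<^sup>2 * tanh d) \<le> 32 * d" using assms(1) by linarith
    then show ?thesis
      using assms(1) tanh_d by (simp add: r_def T_def field_simps power2_eq_square)
  qed
  have "(?Q has_real_derivative p) (at \<alpha>)"
    using field_Q_differentiable[OF assms(1,2)] unfolding p_def
    by (metis DERIV_imp_deriv real_differentiable_def)
  then have tangent: "q - p * (\<alpha> - x) \<le> ?Q x" for x
    using convex_on_imp_above_tangent[OF convex_on_field_Q[OF assms(2)], of \<alpha> x p]
    by (simp add: q_def algebra_simps)
  (* At - \<alpha> the tangent at \<alpha> has height q - 2 p \<alpha>, whereas Q has height q by evenness. *)
  have p: "p \<ge> 0"
    using tangent[of "- \<alpha>"] even[of \<alpha>] assms(6) by (simp add: q_def zero_le_mult_iff)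
  have outside: "q \<le> ?Q x" if "\<alpha> < \<bar>x\<bar>" for x
  proof -
    have "q \<le> q - p * (\<alpha> - \<bar>x\<bar>)" using p that by (simp add: mult_nonneg_nonpos)
    also have "\<dots> \<le> ?Q \<bar>x\<bar>" by (rule tangent)
    also have "\<dots> = ?Q x" using even[of x] by (simp add: abs_if)
    finally show ?thesis .
  qed
  have \<mu>: "sets \<mu> = sets borel" "emeasure \<mu> (space \<mu>) = of_nat n"
    using assms(5) sets_eq_imp_space_eq[of \<mu> borel]
    by (auto simp: energy_minimizer_def borel_measures_def)
  have "finite_measure \<mu>" by (rule finite_measureI) (simp add: \<mu>)
  moreover have "?Q \<in> borel_measurable borel"
    by (intro borel_measurable_continuous_onI continuous_at_imp_continuous_on ballI
        differentiable_imp_continuous_within field_Q_differentiable[OF assms(1,2)])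
  ultimately have main: "ennreal q * of_nat n \<le> F_C d w \<mu> + ennreal (\<alpha> * (r * q + p)\<^sup>2 / (8 * r))"
    using energy_plus_field_ge[OF assms(1) r0 r_ge _ \<mu>(1), of ?Q \<alpha> p q]
      field_Q_nonneg[OF assms(2)] assms(6) p q tangent outside \<mu>(2)
    by (simp add: F_C_def)
  have "\<alpha> * (r * q + p)\<^sup>2 / (8 * r) \<le> q * n / 2"
  proof -
    have sq: "(r * q + p)\<^sup>2 \<le> 3 / 2 * (r\<^sup>2 * q\<^sup>2) + 3 * p\<^sup>2"
    proof -
      have "0 \<le> 1 / 2 * (r * q - 2 * p)\<^sup>2" by simp
      then show ?thesis by (simp add: power2_eq_square algebra_simps)
    qed
    have rT: "r * T = 16 / 3" using T by (simp add: r_def)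
    have "T\<^sup>2 \<le> 10"
    proof -
      have "T\<^sup>2 = pi\<^sup>2 * (tanh d)\<^sup>2" by (simp add: T_def power_mult_distrib)
      also have "\<dots> \<le> 10 * 1" using pi2 tanh_d by (intro mult_mono) (auto simp: power_le_one)
      finally show ?thesis by simp
    qed
    then have T_r: "3 * T / (8 * r) \<le> 1" using T by (simp add: r_def field_simps power2_eq_square)
    have "(r * q + p)\<^sup>2 / (8 * r) * T \<le> (3 / 2 * (r\<^sup>2 * q\<^sup>2) + 3 * p\<^sup>2) / (8 * r) * T"
      using sq r0 T by (intro mult_right_mono divide_right_mono) auto
    also have "\<dots> = 3 / 16 * (r * T) * q\<^sup>2 + 3 * T / (8 * r) * p\<^sup>2"
      using r0 by (simp add: field_simps power2_eq_square)
    also have "\<dots> \<le> q\<^sup>2 + p\<^sup>2"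
      using mult_right_mono[OF T_r, of "p\<^sup>2"] by (simp add: rT)
    finally have "(r * q + p)\<^sup>2 / (8 * r) \<le> (q\<^sup>2 + p\<^sup>2) / T" using T by (simp add: field_simps)
    then have "\<alpha> * ((r * q + p)\<^sup>2 / (8 * r)) \<le> \<alpha> * ((q\<^sup>2 + p\<^sup>2) / T)"
      using assms(6) by (intro mult_left_mono) auto
    also have "\<dots> = q / 2 * (2 * \<alpha> / T * ((q\<^sup>2 + p\<^sup>2) / q))"
      using q T by (simp add: field_simps)
    also have "\<dots> \<le> q / 2 * n"
      using assms(7) q unfolding T_def q_def p_def by (intro mult_left_mono) auto
    finally show ?thesis by simp
  qed
  then have "ennreal (q * n / 2) + ennreal (q * n / 2) \<le> F_C d w \<mu> + ennreal (q * n / 2)"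
    using order_trans[OF main add_left_mono[OF ennreal_leI]] q
    by (simp add: ennreal_plus[symmetric] ennreal_mult ennreal_of_nat_eq_real_of_nat
        del: ennreal_plus)
  then have "ennreal (q * n / 2) \<le> F_C d w \<mu>"
    by (simp add: ennreal_add_left_cancel_le add.commute)
  then have "ennreal (q * n / 2) / of_nat n \<le> F_C d w \<mu> / of_nat n"
    by (rule divide_right_mono_ennreal)
  then show ?thesis
    using assms(4) q by (simp add: q_def ennreal_of_nat_eq_real_of_nat divide_ennreal)
qed

end
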